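(* Let $\mathcal{B}$ be a Serre subcategory of an abelian category $\mathcal{A}$, let $q\colon\mathcal{A}\to\mathcal{C}:=\mathcal{A}/\mathcal{B}$ be the quotient functor, and let $\mathcal{E}\subset\mathcal{A}$ be the full subcategory of $\mathcal{B}$-closed objects. Then the functor $q|_{\mathcal{E}}\colon\mathcal{E}\to\mathcal{C}$ is fully faithful.
   Context: The full subcategory of $\mathcal{B}$-closed objects is $\mathcal{E}=\{A\in\mathcal{A}\mid\operatorname{Hom}(B,A)=0=\operatorname{Ext}^1(B,A)\ \text{for all } B\in\mathcal{B}\}$. *)

theory Defs
  imports Main "HOL-Algebra.Group"
begin

section \<open>Categories and functors\<close>

record ('o, 'm) cat =
  Obj :: "'o set"
  Arr :: "'m set"
  Dom :: "'m \<Rightarrow> 'o"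
  Cod :: "'m \<Rightarrow> 'o"
  Ident :: "'o \<Rightarrow> 'm"
  Comp :: "'m \<Rightarrow> 'm \<Rightarrow> 'm"  \<comment> \<open>\<open>Comp C g f\<close> is g after f\<close>

definition Hom :: "('o, 'm, 'z) cat_scheme \<Rightarrow> 'o \<Rightarrow> 'o \<Rightarrow> 'm set" where
  "Hom C a b = {f \<in> Arr C. Dom C f = a \<and> Cod C f = b}"

locale category =
  fixes C :: "('o, 'm, 'z) cat_scheme"
  assumes Dom_closed: "f \<in> Arr C \<Longrightarrow> Dom C f \<in> Obj C"
    and Cod_closed: "f \<in> Arr C \<Longrightarrow> Cod C f \<in> Obj C"
    and Ident_closed: "a \<in> Obj C \<Longrightarrow> Ident C a \<in> Hom C a a"
    and Comp_closed: "f \<in> Hom C a b \<Longrightarrow> g \<in> Hom C b c \<Longrightarrow> Comp C g f \<in> Hom C a c"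
    and Ident_left: "f \<in> Hom C a b \<Longrightarrow> Comp C (Ident C b) f = f"
    and Ident_right: "f \<in> Hom C a b \<Longrightarrow> Comp C f (Ident C a) = f"
    and Comp_assoc: "f \<in> Hom C a b \<Longrightarrow> g \<in> Hom C b c \<Longrightarrow> h \<in> Hom C c d
      \<Longrightarrow> Comp C h (Comp C g f) = Comp C (Comp C h g) f"

definition is_iso :: "('o, 'm, 'z) cat_scheme \<Rightarrow> 'm \<Rightarrow> bool" where
  "is_iso C f \<longleftrightarrow> f \<in> Arr C \<and> (\<exists>g \<in> Hom C (Cod C f) (Dom C f).
     Comp C g f = Ident C (Dom C f) \<and> Comp C f g = Ident C (Cod C f))"

definition is_mono :: "('o, 'm, 'z) cat_scheme \<Rightarrow> 'm \<Rightarrow> bool" where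
  "is_mono C f \<longleftrightarrow> f \<in> Arr C \<and> (\<forall>x. \<forall>g \<in> Hom C x (Dom C f). \<forall>h \<in> Hom C x (Dom C f).
     Comp C f g = Comp C f h \<longrightarrow> g = h)"

definition is_epi :: "('o, 'm, 'z) cat_scheme \<Rightarrow> 'm \<Rightarrow> bool" where
  "is_epi C f \<longleftrightarrow> f \<in> Arr C \<and> (\<forall>x. \<forall>g \<in> Hom C (Cod C f) x. \<forall>h \<in> Hom C (Cod C f) x.
     Comp C g f = Comp C h f \<longrightarrow> g = h)"

definition full_subcat :: "('o, 'm, 'z) cat_scheme \<Rightarrow> 'o set \<Rightarrow> ('o, 'm) cat" where
  "full_subcat C X = \<lparr>Obj = Obj C \<inter> X, Arr = {f \<in> Arr C. Dom C f \<in> X \<and> Cod C f \<in> X},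
     Dom = Dom C, Cod = Cod C, Ident = Ident C, Comp = Comp C\<rparr>"

record ('o, 'm, 'p, 'n) func =
  FObj :: "'o \<Rightarrow> 'p"
  FArr :: "'m \<Rightarrow> 'n"

definition is_functor ::
  "('o, 'm, 'y) cat_scheme \<Rightarrow> ('p, 'n, 'z) cat_scheme \<Rightarrow> ('o, 'm, 'p, 'n) func \<Rightarrow> bool" where
  "is_functor C D F \<longleftrightarrow> category C \<and> category D \<and>
     (\<forall>a \<in> Obj C. FObj F a \<in> Obj D) \<and>
     (\<forall>a b. \<forall>f \<in> Hom C a b. FArr F f \<in> Hom D (FObj F a) (FObj F b)) \<and>
     (\<forall>a \<in> Obj C. FArr F (Ident C a) = Ident D (FObj F a)) \<and>
     (\<forall>a b c. \<forall>f \<in> Hom C a b. \<forall>g \<in> Hom C b c.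
        FArr F (Comp C g f) = Comp D (FArr F g) (FArr F f))"

definition fully_faithful ::
  "('o, 'm, 'y) cat_scheme \<Rightarrow> ('p, 'n, 'z) cat_scheme \<Rightarrow> ('o, 'm, 'p, 'n) func \<Rightarrow> bool" where
  "fully_faithful C D F \<longleftrightarrow> is_functor C D F \<and>
     (\<forall>a \<in> Obj C. \<forall>b \<in> Obj C.
        bij_betw (FArr F) (Hom C a b) (Hom D (FObj F a) (FObj F b)))"

definition inclusion_functor :: "('o, 'm, 'o, 'm) func" where
  "inclusion_functor = \<lparr>FObj = (\<lambda>a. a), FArr = (\<lambda>f. f)\<rparr>"

definition func_comp ::
  "('p, 'n, 'q, 'k) func \<Rightarrow> ('o, 'm, 'p, 'n) func \<Rightarrow> ('o, 'm, 'q, 'k) func" where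
  "func_comp G F = \<lparr>FObj = FObj G \<circ> FObj F, FArr = FArr G \<circ> FArr F\<rparr>"


section \<open>Abelian categories\<close>

record ('o, 'm) pcat = "('o, 'm) cat" +
  Add :: "'m \<Rightarrow> 'm \<Rightarrow> 'm"
  Zero :: "'o \<Rightarrow> 'o \<Rightarrow> 'm"

definition Hom_group :: "('o, 'm, 'z) pcat_scheme \<Rightarrow> 'o \<Rightarrow> 'o \<Rightarrow> 'm monoid" where
  "Hom_group C a b = \<lparr>carrier = Hom C a b, mult = Add C, one = Zero C a b\<rparr>"

locale preadditive_category = category C
  for C :: "('o, 'm, 'z) pcat_scheme" +
  assumes Hom_comm_group: "a \<in> Obj C \<Longrightarrow> b \<in> Obj C \<Longrightarrow> comm_group (Hom_group C a b)"
    and Comp_Add_left: "f \<in> Hom C a b \<Longrightarrow> g \<in> Hom C b c \<Longrightarrow> g' \<in> Hom C b c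
      \<Longrightarrow> Comp C (Add C g g') f = Add C (Comp C g f) (Comp C g' f)"
    and Comp_Add_right: "f \<in> Hom C a b \<Longrightarrow> f' \<in> Hom C a b \<Longrightarrow> g \<in> Hom C b c
      \<Longrightarrow> Comp C g (Add C f f') = Add C (Comp C g f) (Comp C g f')"

definition is_zero_object :: "('o, 'm, 'z) cat_scheme \<Rightarrow> 'o \<Rightarrow> bool" where
  "is_zero_object C z \<longleftrightarrow> z \<in> Obj C \<and>
     (\<forall>a \<in> Obj C. (\<exists>!f. f \<in> Hom C z a) \<and> (\<exists>!f. f \<in> Hom C a z))"

definition is_biproduct ::
  "('o, 'm, 'z) pcat_scheme \<Rightarrow> 'o \<Rightarrow> 'o \<Rightarrow> 'o \<Rightarrow> 'm \<Rightarrow> 'm \<Rightarrow> 'm \<Rightarrow> 'm \<Rightarrow> bool" where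
  "is_biproduct C a b e i1 i2 p1 p2 \<longleftrightarrow>
     i1 \<in> Hom C a e \<and> i2 \<in> Hom C b e \<and> p1 \<in> Hom C e a \<and> p2 \<in> Hom C e b \<and>
     Comp C p1 i1 = Ident C a \<and> Comp C p2 i2 = Ident C b \<and>
     Comp C p2 i1 = Zero C a b \<and> Comp C p1 i2 = Zero C b a \<and>
     Add C (Comp C i1 p1) (Comp C i2 p2) = Ident C e"

definition is_kernel :: "('o, 'm, 'z) pcat_scheme \<Rightarrow> 'm \<Rightarrow> 'm \<Rightarrow> bool" where
  "is_kernel C f k \<longleftrightarrow> f \<in> Arr C \<and> k \<in> Hom C (Dom C k) (Dom C f) \<and>
     Comp C f k = Zero C (Dom C k) (Cod C f) \<and>
     (\<forall>x. \<forall>g \<in> Hom C x (Dom C f). Comp C f g = Zero C x (Cod C f) \<longrightarrow>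
        (\<exists>!h. h \<in> Hom C x (Dom C k) \<and> Comp C k h = g))"

definition is_cokernel :: "('o, 'm, 'z) pcat_scheme \<Rightarrow> 'm \<Rightarrow> 'm \<Rightarrow> bool" where
  "is_cokernel C f c \<longleftrightarrow> f \<in> Arr C \<and> c \<in> Hom C (Cod C f) (Cod C c) \<and>
     Comp C c f = Zero C (Dom C f) (Cod C c) \<and>
     (\<forall>x. \<forall>g \<in> Hom C (Cod C f) x. Comp C g f = Zero C (Dom C f) x \<longrightarrow>
        (\<exists>!h. h \<in> Hom C (Cod C c) x \<and> Comp C h c = g))"

locale abelian_category = preadditive_category C
  for C :: "('o, 'm, 'z) pcat_scheme" +
  assumes ex_zero_object: "\<exists>z. is_zero_object C z"
    and ex_biproduct: "a \<in> Obj C \<Longrightarrow> b \<in> Obj C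
      \<Longrightarrow> \<exists>e i1 i2 p1 p2. is_biproduct C a b e i1 i2 p1 p2"
    and ex_kernel: "f \<in> Arr C \<Longrightarrow> \<exists>k. is_kernel C f k"
    and ex_cokernel: "f \<in> Arr C \<Longrightarrow> \<exists>c. is_cokernel C f c"
    and mono_is_kernel: "is_mono C m \<Longrightarrow> \<exists>f. is_kernel C f m"
    and epi_is_cokernel: "is_epi C p \<Longrightarrow> \<exists>f. is_cokernel C f p"

definition short_exact :: "('o, 'm, 'z) pcat_scheme \<Rightarrow> 'm \<Rightarrow> 'm \<Rightarrow> bool" where
  "short_exact C i p \<longleftrightarrow> is_kernel C p i \<and> is_cokernel C i p"


section \<open>Yoneda's first extension group\<close>

text \<open>An extension \<open>0 \<rightarrow> a \<rightarrow> e \<rightarrow> b \<rightarrow> 0\<close> is encoded by its pair of arrows, which determine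
  the middle object.\<close>

definition extensions :: "('o, 'm, 'z) pcat_scheme \<Rightarrow> 'o \<Rightarrow> 'o \<Rightarrow> ('m \<times> 'm) set" where
  "extensions C b a = {(i, p). short_exact C i p \<and> Dom C i = a \<and> Cod C p = b}"

definition ext_equiv ::
  "('o, 'm, 'z) pcat_scheme \<Rightarrow> 'o \<Rightarrow> 'o \<Rightarrow> (('m \<times> 'm) \<times> ('m \<times> 'm)) set" where
  "ext_equiv C b a = {((i, p), (i', p')).
     (i, p) \<in> extensions C b a \<and> (i', p') \<in> extensions C b a \<and>
     (\<exists>h \<in> Hom C (Cod C i) (Cod C i'). is_iso C h \<and> Comp C h i = i' \<and> Comp C p' h = p)}"

definition Ext1 :: "('o, 'm, 'z) pcat_scheme \<Rightarrow> 'o \<Rightarrow> 'o \<Rightarrow> ('m \<times> 'm) set set" where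
  "Ext1 C b a = extensions C b a // ext_equiv C b a"

text \<open>The neutral element for the Baer sum is the class of \<open>0 \<rightarrow> a \<rightarrow> a \<oplus> b \<rightarrow> b \<rightarrow> 0\<close>.  The sum itself
  is not needed to say that the group vanishes.\<close>

definition Ext1_zero :: "('o, 'm, 'z) pcat_scheme \<Rightarrow> 'o \<Rightarrow> 'o \<Rightarrow> ('m \<times> 'm) set" where
  "Ext1_zero C b a = {(i, p). \<exists>e r s. is_biproduct C a b e i s r p}"


section \<open>Localization of a category at a set of arrows\<close>

text \<open>The construction of Gabriel and Zisman: arrows of the localization are zigzags, read from
  left to right in the order of travel, modulo the least congruence that makes the
  forward steps functorial and makes \<open>Bwd s\<close> a two-sided inverse of \<open>Fwd s\<close>.\<close>

datatype 'm zstep = Fwd 'm | Bwd 'm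

inductive zpath :: "('o, 'm, 'z) cat_scheme \<Rightarrow> 'm set \<Rightarrow> 'o \<Rightarrow> 'm zstep list \<Rightarrow> 'o \<Rightarrow> bool"
  for C S where
  zpath_Nil: "a \<in> Obj C \<Longrightarrow> zpath C S a [] a"
| zpath_Fwd: "f \<in> Arr C \<Longrightarrow> zpath C S (Cod C f) w b \<Longrightarrow> zpath C S (Dom C f) (Fwd f # w) b"
| zpath_Bwd: "s \<in> S \<Longrightarrow> s \<in> Arr C \<Longrightarrow> zpath C S (Dom C s) w b
    \<Longrightarrow> zpath C S (Cod C s) (Bwd s # w) b"

inductive zeq ::
  "('o, 'm, 'z) cat_scheme \<Rightarrow> 'm set \<Rightarrow> 'o \<Rightarrow> 'o \<Rightarrow> 'm zstep list \<Rightarrow> 'm zstep list \<Rightarrow> bool"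
  for C S where
  zeq_refl: "zpath C S a w b \<Longrightarrow> zeq C S a b w w"
| zeq_sym: "zeq C S a b w w' \<Longrightarrow> zeq C S a b w' w"
| zeq_trans: "zeq C S a b w w' \<Longrightarrow> zeq C S a b w' w'' \<Longrightarrow> zeq C S a b w w''"
| zeq_append: "zeq C S a b v v' \<Longrightarrow> zeq C S b c w w' \<Longrightarrow> zeq C S a c (v @ w) (v' @ w')"
| zeq_Comp: "f \<in> Hom C a b \<Longrightarrow> g \<in> Hom C b c
    \<Longrightarrow> zeq C S a c [Fwd f, Fwd g] [Fwd (Comp C g f)]"
| zeq_Ident: "a \<in> Obj C \<Longrightarrow> zeq C S a a [Fwd (Ident C a)] []"
| zeq_Fwd_Bwd: "s \<in> S \<Longrightarrow> s \<in> Hom C a b \<Longrightarrow> zeq C S a a [Fwd s, Bwd s] []"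
| zeq_Bwd_Fwd: "s \<in> S \<Longrightarrow> s \<in> Hom C a b \<Longrightarrow> zeq C S b b [Bwd s, Fwd s] []"

definition zclass ::
  "('o, 'm, 'z) cat_scheme \<Rightarrow> 'm set \<Rightarrow> 'o \<Rightarrow> 'o \<Rightarrow> 'm zstep list \<Rightarrow> 'm zstep list set" where
  "zclass C S a b w = {w'. zeq C S a b w w'}"

text \<open>Arrows of the localization carry their domain and codomain explicitly.\<close>

definition localization ::
  "('o, 'm, 'z) cat_scheme \<Rightarrow> 'm set \<Rightarrow> ('o, 'o \<times> 'm zstep list set \<times> 'o) cat" where
  "localization C S = \<lparr>Obj = Obj C,
     Arr = {(a, zclass C S a b w, b) | a b w. zpath C S a w b},
     Dom = (\<lambda>(a, K, b). a),
     Cod = (\<lambda>(a, K, b). b),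
     Ident = (\<lambda>a. (a, zclass C S a a [], a)),
     Comp = (\<lambda>(b', L, c) (a, K, b). (a, \<Union>v \<in> K. \<Union>w \<in> L. zclass C S a c (v @ w), c))\<rparr>"

definition localization_functor ::
  "('o, 'm, 'z) cat_scheme \<Rightarrow> 'm set \<Rightarrow> ('o, 'm, 'o, 'o \<times> 'm zstep list set \<times> 'o) func" where
  "localization_functor C S = \<lparr>FObj = (\<lambda>a. a),
     FArr = (\<lambda>f. (Dom C f, zclass C S (Dom C f) (Cod C f) [Fwd f], Cod C f))\<rparr>"


text \<open>The construction does what it should: it yields a category and a functor that inverts \<open>S\<close>,
  and every functor inverting \<open>S\<close> factors uniquely through it.\<close>

context category
begin

lemma zpath_Obj: "zpath C S a w b \<Longrightarrow> a \<in> Obj C \<and> b \<in> Obj C"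
  by (induction rule: zpath.induct) (auto simp: Dom_closed Cod_closed)

lemma zpath_append: "zpath C S a v b \<Longrightarrow> zpath C S b w c \<Longrightarrow> zpath C S a (v @ w) c"
  by (induction rule: zpath.induct) (auto intro: zpath.intros)

lemma zpath_single_Fwd: "f \<in> Hom C a b \<Longrightarrow> zpath C S a [Fwd f] b"
  unfolding Hom_def by (auto intro!: zpath.intros Cod_closed)

lemma zpath_single_Bwd: "s \<in> S \<Longrightarrow> s \<in> Hom C a b \<Longrightarrow> zpath C S b [Bwd s] a"
  unfolding Hom_def by (auto intro!: zpath.intros Dom_closed)

lemma zeq_zpath: "zeq C S a b w w' \<Longrightarrow> zpath C S a w b \<and> zpath C S a w' b"
proof (induction rule: zeq.induct)
  case (zeq_append a b v v' c w w')
  then show ?case by (auto intro: zpath_append)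
next
  case (zeq_Comp f a b g c)
  then have "zpath C S a ([Fwd f] @ [Fwd g]) c"
    by (intro zpath_append zpath_single_Fwd)
  moreover have "zpath C S a [Fwd (Comp C g f)] c"
    by (intro zpath_single_Fwd Comp_closed[OF zeq_Comp])
  ultimately show ?case by simp
next
  case (zeq_Ident a)
  then show ?case
    by (auto intro: zpath_single_Fwd Ident_closed zpath_Nil)
next
  case (zeq_Fwd_Bwd s a b)
  then have "zpath C S a ([Fwd s] @ [Bwd s]) a"
    by (intro zpath_append[OF zpath_single_Fwd zpath_single_Bwd])
  with zpath_Obj show ?case by (auto intro: zpath.intros)
next
  case (zeq_Bwd_Fwd s a b)
  then have "zpath C S b ([Bwd s] @ [Fwd s]) b"
    by (intro zpath_append[OF zpath_single_Bwd zpath_single_Fwd])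
  with zpath_Obj show ?case by (auto intro: zpath.intros)
qed auto

lemma zclass_eq_iff:
  assumes "zpath C S a w b"
  shows "zclass C S a b v = zclass C S a b w \<longleftrightarrow> zeq C S a b v w"
  using assms unfolding zclass_def by (blast intro: zeq_refl zeq_sym zeq_trans)

lemma Hom_localization:
  "Hom (localization C S) a b = {(a, zclass C S a b w, b) | w. zpath C S a w b}"
  by (auto simp: Hom_def localization_def)

lemma Comp_localization:
  assumes v: "zpath C S a v b" and w: "zpath C S b w c"
  shows "Comp (localization C S) (b, zclass C S b c w, c) (a, zclass C S a b v, b)
    = (a, zclass C S a c (v @ w), c)"
proof -
  have "zclass C S a c (v' @ w') = zclass C S a c (v @ w)"
    if "v' \<in> zclass C S a b v" "w' \<in> zclass C S b c w" for v' w'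
    using that zpath_append[OF v w]
    by (subst zclass_eq_iff) (auto simp: zclass_def intro: zeq_append zeq_sym)
  moreover have "v \<in> zclass C S a b v" "w \<in> zclass C S b c w"
    using v w by (auto simp: zclass_def intro: zeq_refl)
  ultimately have "(\<Union>v' \<in> zclass C S a b v. \<Union>w' \<in> zclass C S b c w. zclass C S a c (v' @ w'))
    = zclass C S a c (v @ w)" by blast
  then show ?thesis by (simp add: localization_def)
qed

lemma category_localization: "category (localization C S)"
proof
  fix f assume "f \<in> Arr (localization C S)"
  then show "Dom (localization C S) f \<in> Obj (localization C S)"
    "Cod (localization C S) f \<in> Obj (localization C S)"
    by (auto simp: localization_def dest: zpath_Obj)
next
  fix a assume "a \<in> Obj (localization C S)"
  then show "Ident (localization C S) a \<in> Hom (localization C S) a a"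
    by (auto simp: Hom_localization) (auto simp: localization_def intro: zpath_Nil)
next
  fix a b c f g
  assume "f \<in> Hom (localization C S) a b" "g \<in> Hom (localization C S) b c"
  then show "Comp (localization C S) g f \<in> Hom (localization C S) a c"
    by (auto simp: Hom_localization Comp_localization intro: zpath_append)
next
  fix a b f assume "f \<in> Hom (localization C S) a b"
  then obtain w where w: "zpath C S a w b" "f = (a, zclass C S a b w, b)"
    by (auto simp: Hom_localization)
  have n: "zpath C S a [] a" "zpath C S b [] b"
    using zpath_Obj[OF w(1)] by (auto intro: zpath_Nil)
  have i: "Ident (localization C S) x = (x, zclass C S x x [], x)" for x
    by (simp add: localization_def)
  show "Comp (localization C S) (Ident (localization C S) b) f = f"
    "Comp (localization C S) f (Ident (localization C S) a) = f"
    using Comp_localization[OF w(1) n(2)] Comp_localization[OF n(1) w(1)] by (auto simp: i w(2))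
next
  fix a b c d f g h
  assume "f \<in> Hom (localization C S) a b" "g \<in> Hom (localization C S) b c"
    "h \<in> Hom (localization C S) c d"
  then obtain u v w where p: "zpath C S a u b" "zpath C S b v c" "zpath C S c w d"
    and e: "f = (a, zclass C S a b u, b)" "g = (b, zclass C S b c v, c)"
      "h = (c, zclass C S c d w, d)"
    by (auto simp: Hom_localization)
  show "Comp (localization C S) h (Comp (localization C S) g f)
    = Comp (localization C S) (Comp (localization C S) h g) f"
    using p by (simp add: e Comp_localization zpath_append)
qed

lemma is_functor_localization: "is_functor C (localization C S) (localization_functor C S)"
proof -
  have "(a, zclass C S a a [Fwd (Ident C a)], a) = Ident (localization C S) a" if "a \<in> Obj C" for a
    using zeq_Ident[OF that] zpath_Nil[OF that] by (simp add: localization_def zclass_eq_iff)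
  moreover have "(a, zclass C S a c [Fwd (Comp C g f)], c) = Comp (localization C S)
      (b, zclass C S b c [Fwd g], c) (a, zclass C S a b [Fwd f], b)"
    if f: "f \<in> Hom C a b" and g: "g \<in> Hom C b c" for a b c f g
  proof -
    have p: "zpath C S a [Fwd f] b" "zpath C S b [Fwd g] c"
      using f g by (auto intro: zpath_single_Fwd)
    have e: "zeq C S a c [Fwd f, Fwd g] [Fwd (Comp C g f)]"
      using f g by (rule zeq_Comp)
    have "zclass C S a c [Fwd (Comp C g f)] = zclass C S a c [Fwd f, Fwd g]"
      by (simp add: zclass_eq_iff[OF conjunct1[OF zeq_zpath[OF e]]] zeq_sym[OF e])
    then show ?thesis using Comp_localization[OF p] by simp
  qed
  moreover have "Dom C (Comp C g f) = a" "Cod C (Comp C g f) = c"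
    if "f \<in> Hom C a b" "g \<in> Hom C b c" for a b c f g
    using Comp_closed[OF that] by (auto simp: Hom_def)
  moreover have "Dom C (Ident C a) = a" "Cod C (Ident C a) = a" if "a \<in> Obj C" for a
    using Ident_closed[OF that] by (auto simp: Hom_def)
  moreover have "(a, zclass C S a b [Fwd f], b) \<in> Hom (localization C S) a b"
    if "f \<in> Hom C a b" for a b f
    using that by (auto simp: Hom_localization intro: zpath_single_Fwd)
  moreover have "Obj (localization C S) = Obj C" by (simp add: localization_def)
  ultimately show ?thesis
    using category_axioms category_localization
    unfolding is_functor_def localization_functor_def
    by (auto simp: Hom_def[of C])
qed

lemma localization_Bwd_inverse:
  assumes "s \<in> S" "s \<in> Hom C a b"
  shows "(b, zclass C S b a [Bwd s], a) \<in> Hom (localization C S) b a"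
    and "Comp (localization C S) (b, zclass C S b a [Bwd s], a) (FArr (localization_functor C S) s)
      = Ident (localization C S) a"
    and "Comp (localization C S) (FArr (localization_functor C S) s) (b, zclass C S b a [Bwd s], a)
      = Ident (localization C S) b"
proof -
  have p: "zpath C S a [Fwd s] b" "zpath C S b [Bwd s] a"
    using assms by (auto intro: zpath_single_Fwd zpath_single_Bwd)
  then show "(b, zclass C S b a [Bwd s], a) \<in> Hom (localization C S) b a"
    by (auto simp: Hom_localization)
  have q: "FArr (localization_functor C S) s = (a, zclass C S a b [Fwd s], b)"
    using assms by (simp add: localization_functor_def Hom_def)
  have "zclass C S a a [Fwd s, Bwd s] = zclass C S a a []"
    "zclass C S b b [Bwd s, Fwd s] = zclass C S b b []"
    using assms zpath_Obj[OF p(1)]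
    by (auto simp: zclass_eq_iff zpath_Nil intro: zeq_Fwd_Bwd zeq_Bwd_Fwd)
  then show "Comp (localization C S) (b, zclass C S b a [Bwd s], a)
      (FArr (localization_functor C S) s) = Ident (localization C S) a"
    "Comp (localization C S) (FArr (localization_functor C S) s)
      (b, zclass C S b a [Bwd s], a) = Ident (localization C S) b"
    using Comp_localization[OF p] Comp_localization[OF p(2,1)]
    by (simp_all add: q, simp_all add: localization_def)
qed

lemma localization_inverts:
  assumes "s \<in> S" "s \<in> Arr C"
  shows "is_iso (localization C S) (FArr (localization_functor C S) s)"
proof -
  have s: "s \<in> Hom C (Dom C s) (Cod C s)" using assms by (simp add: Hom_def)
  have "FArr (localization_functor C S) s \<in> Hom (localization C S) (Dom C s) (Cod C s)"
    using is_functor_localization s by (simp add: is_functor_def localization_functor_def)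
  then show ?thesis
    using localization_Bwd_inverse[OF assms(1) s] by (auto simp: is_iso_def Hom_def)
qed

end

definition iso_inv :: "('o, 'm, 'z) cat_scheme \<Rightarrow> 'm \<Rightarrow> 'm" where
  "iso_inv D f = (SOME g. g \<in> Hom D (Cod D f) (Dom D f) \<and>
     Comp D g f = Ident D (Dom D f) \<and> Comp D f g = Ident D (Cod D f))"

lemma iso_inv:
  assumes "is_iso D f" "f \<in> Hom D a b"
  shows "iso_inv D f \<in> Hom D b a" "Comp D (iso_inv D f) f = Ident D a"
    "Comp D f (iso_inv D f) = Ident D b"
proof -
  have "\<exists>g. g \<in> Hom D (Cod D f) (Dom D f) \<and>
     Comp D g f = Ident D (Dom D f) \<and> Comp D f g = Ident D (Cod D f)"
    using assms(1) by (auto simp: is_iso_def)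
  from someI_ex[OF this] show "iso_inv D f \<in> Hom D b a" "Comp D (iso_inv D f) f = Ident D a"
    "Comp D f (iso_inv D f) = Ident D b"
    using assms(2) by (auto simp: iso_inv_def Hom_def)
qed

lemma iso_inv_unique:
  assumes "category D" "is_iso D f" "f \<in> Hom D a b" "g \<in> Hom D b a" "Comp D g f = Ident D a"
  shows "g = iso_inv D f"
  using iso_inv[OF assms(2,3)] category.Comp_assoc[OF assms(1) iso_inv(1)[OF assms(2,3)] assms(3,4)]
    category.Ident_right[OF assms(1,4)] category.Ident_left[OF assms(1), of "iso_inv D f" b a] assms(5)
  by simp

text \<open>The arrow of \<open>D\<close> obtained by composing a zigzag with target \<open>b\<close> under \<open>F\<close>.\<close>

primrec zval :: "('o, 'm, 'y) cat_scheme \<Rightarrow> ('p, 'n, 'z) cat_scheme \<Rightarrow> ('o, 'm, 'p, 'n) func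
    \<Rightarrow> 'o \<Rightarrow> 'm zstep list \<Rightarrow> 'n" where
  "zval C D F b [] = Ident D (FObj F b)"
| "zval C D F b (x # w) = Comp D (zval C D F b w)
     (case x of Fwd f \<Rightarrow> FArr F f | Bwd s \<Rightarrow> iso_inv D (FArr F s))"

context
  fixes C :: "('o, 'm, 'y) cat_scheme" and D :: "('p, 'n, 'z) cat_scheme" and F and S
  assumes F: "is_functor C D F"
    and inv: "\<And>s. s \<in> S \<Longrightarrow> s \<in> Arr C \<Longrightarrow> is_iso D (FArr F s)"
begin

interpretation C: category C using F by (simp add: is_functor_def)
interpretation D: category D using F by (simp add: is_functor_def)

private lemma F_Hom: "f \<in> Hom C a b \<Longrightarrow> FArr F f \<in> Hom D (FObj F a) (FObj F b)"
  and F_Ident: "a \<in> Obj C \<Longrightarrow> FArr F (Ident C a) = Ident D (FObj F a)"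
  and F_Comp: "f \<in> Hom C a b \<Longrightarrow> g \<in> Hom C b c \<Longrightarrow>
    FArr F (Comp C g f) = Comp D (FArr F g) (FArr F f)"
  and F_Obj: "a \<in> Obj C \<Longrightarrow> FObj F a \<in> Obj D"
  using F by (auto simp: is_functor_def)

private lemma F_inv:
  assumes "s \<in> S" "s \<in> Hom C a b"
  shows "iso_inv D (FArr F s) \<in> Hom D (FObj F b) (FObj F a)"
    "Comp D (iso_inv D (FArr F s)) (FArr F s) = Ident D (FObj F a)"
    "Comp D (FArr F s) (iso_inv D (FArr F s)) = Ident D (FObj F b)"
  using iso_inv[OF inv F_Hom, of s a b] assms by (auto simp: Hom_def)

lemma zval_Hom: "zpath C S a w b \<Longrightarrow> zval C D F b w \<in> Hom D (FObj F a) (FObj F b)"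
proof (induction rule: zpath.induct)
  case (zpath_Nil a)
  then show ?case by (simp add: F_Obj D.Ident_closed)
next
  case (zpath_Fwd f w b)
  then show ?case using F_Hom[of f "Dom C f" "Cod C f"] by (auto simp: Hom_def[of C] intro: D.Comp_closed)
next
  case (zpath_Bwd s w b)
  then show ?case using F_inv(1)[of s "Dom C s" "Cod C s"] by (auto simp: Hom_def[of C] intro: D.Comp_closed)
qed

lemma zval_append:
  assumes "zpath C S a v b" and w: "zpath C S b w c"
  shows "zval C D F c (v @ w) = Comp D (zval C D F c w) (zval C D F b v)"
  using assms
proof (induction rule: zpath.induct)
  case (zpath_Nil a)
  then show ?case by (simp add: D.Ident_right[OF zval_Hom])
next
  case (zpath_Fwd f v b)
  then show ?case
    using D.Comp_assoc[OF F_Hom[of f "Dom C f" "Cod C f"] zval_Hom zval_Hom]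
    by (auto simp: Hom_def[of C])
next
  case (zpath_Bwd s v b)
  then show ?case
    using D.Comp_assoc[OF F_inv(1)[of s "Dom C s" "Cod C s"] zval_Hom zval_Hom]
    by (auto simp: Hom_def[of C])
qed

lemma zval_Fwd: "f \<in> Hom C a b \<Longrightarrow> zval C D F b [Fwd f] = FArr F f"
  by (simp add: D.Ident_left[OF F_Hom])

lemma zval_zeq: "zeq C S a b w w' \<Longrightarrow> zval C D F b w = zval C D F b w'"
proof (induction rule: zeq.induct)
  case (zeq_append a b v v' c w w')
  then show ?case
    using C.zeq_zpath[OF zeq_append(1)] C.zeq_zpath[OF zeq_append(2)]
    by (metis zval_append)
next
  case (zeq_Comp f a b g c)
  then show ?case
    using zval_Fwd[OF C.Comp_closed[OF zeq_Comp]] zval_Fwd[OF zeq_Comp(2)] F_Comp[OF zeq_Comp] by simp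
next
  case (zeq_Ident a)
  then show ?case using zval_Fwd[OF C.Ident_closed[OF zeq_Ident]] by (simp add: F_Ident)
next
  case (zeq_Fwd_Bwd s a b)
  then show ?case by (simp add: D.Ident_left[OF F_inv(1)] F_inv)
next
  case (zeq_Bwd_Fwd s a b)
  then show ?case using zval_Fwd[of s a b] by (simp add: F_inv)
qed auto

theorem localization_universal:
  "\<exists>G. is_functor (localization C S) D G \<and>
     (\<forall>a \<in> Obj C. FObj G (FObj (localization_functor C S) a) = FObj F a) \<and>
     (\<forall>f \<in> Arr C. FArr G (FArr (localization_functor C S) f) = FArr F f)"
proof -
  define G :: "('o, 'o \<times> 'm zstep list set \<times> 'o, 'p, 'n) func"
    where "G = \<lparr>FObj = FObj F, FArr = (\<lambda>(a, K, b). zval C D F b (SOME w. w \<in> K))\<rparr>"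
  have G: "FArr G (a, zclass C S a b w, b) = zval C D F b w" if "zpath C S a w b" for a b w
  proof -
    have "w \<in> zclass C S a b w" using that by (simp add: zclass_def zeq_refl)
    then have "(SOME w'. w' \<in> zclass C S a b w) \<in> zclass C S a b w" by (rule someI)
    then show ?thesis by (simp add: G_def zclass_def zval_zeq)
  qed
  have "is_functor (localization C S) D G"
    unfolding is_functor_def
  proof (intro conjI allI ballI)
    show "category (localization C S)" by (rule C.category_localization)
    show "category D" by (rule D.category_axioms)
    show "FObj G a \<in> Obj D" if "a \<in> Obj (localization C S)" for a
      using that F_Obj by (simp add: localization_def G_def)
    show "FArr G f \<in> Hom D (FObj G a) (FObj G b)" if f: "f \<in> Hom (localization C S) a b" for a b f
    proof -
      obtain w where "zpath C S a w b" "f = (a, zclass C S a b w, b)"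
        using f by (auto simp: C.Hom_localization)
      then show ?thesis using zval_Hom by (auto simp: G) (simp add: G_def)
    qed
    show "FArr G (Ident (localization C S) a) = Ident D (FObj G a)"
      if "a \<in> Obj (localization C S)" for a
    proof -
      have "zpath C S a [] a" using that by (auto simp: localization_def intro: zpath_Nil)
      from G[OF this] show ?thesis by (simp add: localization_def, simp add: G_def)
    qed
    show "FArr G (Comp (localization C S) g f) = Comp D (FArr G g) (FArr G f)"
      if "f \<in> Hom (localization C S) a b" "g \<in> Hom (localization C S) b c" for a b c f g
      using that by (auto simp: C.Hom_localization C.Comp_localization G C.zpath_append zval_append)
  qed
  moreover have "FArr G (FArr (localization_functor C S) f) = FArr F f" if "f \<in> Arr C" for f
    using G[OF C.zpath_single_Fwd, of f "Dom C f" "Cod C f"] zval_Fwd[of f "Dom C f" "Cod C f"] that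
    by (simp add: localization_functor_def Hom_def)
  ultimately show ?thesis
    by (intro exI[of _ G]) (simp add: G_def localization_functor_def)
qed

theorem localization_unique:
  assumes G: "is_functor (localization C S) D G"
    and G_Obj: "\<forall>a \<in> Obj C. FObj G (FObj (localization_functor C S) a) = FObj F a"
    and G_Arr: "\<forall>f \<in> Arr C. FArr G (FArr (localization_functor C S) f) = FArr F f"
    and w: "zpath C S a w b"
  shows "FArr G (a, zclass C S a b w, b) = zval C D F b w"
proof -
  have GC: "FArr G (Comp (localization C S) g f) = Comp D (FArr G g) (FArr G f)"
    if "f \<in> Hom (localization C S) a b" "g \<in> Hom (localization C S) b c" for a b c f g
    using G that by (auto simp: is_functor_def)
  have GO: "FObj G a = FObj F a" if "a \<in> Obj C" for a
    using G_Obj that by (simp add: localization_functor_def)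
  have GI: "FArr G (Ident (localization C S) a) = Ident D (FObj F a)" if "a \<in> Obj C" for a
    using G that GO[OF that] by (simp add: is_functor_def localization_def)
  have step: "FArr G (a, zclass C S a b (x # w), b)
      = Comp D (FArr G (c, zclass C S c b w, b)) (FArr G (a, zclass C S a c [x], c))"
    if "zpath C S a [x] c" "zpath C S c w b" for a b c x w
    using that GC[of "(a, zclass C S a c [x], c)" a c "(c, zclass C S c b w, b)" b]
    by (auto simp: C.Hom_localization C.Comp_localization)
  show ?thesis
    using w
  proof (induction rule: zpath.induct)
    case (zpath_Nil a)
    then show ?case using GI[of a] by (simp add: localization_def)
  next
    case (zpath_Fwd f w b)
    then show ?case
      using step[OF C.zpath_single_Fwd zpath_Fwd(2), of f "Dom C f"] G_Arr
      by (simp add: localization_functor_def Hom_def)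
  next
    case (zpath_Bwd s w b)
    have s: "s \<in> Hom C (Dom C s) (Cod C s)" using zpath_Bwd by (simp add: Hom_def)
    let ?q = "FArr (localization_functor C S) s"
      and ?r = "(Cod C s, zclass C S (Cod C s) (Dom C s) [Bwd s], Dom C s)"
    note r = C.localization_Bwd_inverse[OF zpath_Bwd(1) s]
    have o: "Dom C s \<in> Obj C" "Cod C s \<in> Obj C" using s by (auto simp: Hom_def C.Dom_closed C.Cod_closed)
    have q: "?q \<in> Hom (localization C S) (Dom C s) (Cod C s)"
      using C.is_functor_localization s by (simp add: is_functor_def localization_functor_def)
    have "FArr G ?r \<in> Hom D (FObj F (Cod C s)) (FObj F (Dom C s))"
      using G r(1) GO o unfolding is_functor_def by metis
    moreover have "Comp D (FArr G ?r) (FArr F s) = Ident D (FObj F (Dom C s))"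
      using GC[OF q r(1)] r(2) GI[OF o(1)] G_Arr zpath_Bwd(2) by simp
    ultimately have "FArr G ?r = iso_inv D (FArr F s)"
      using iso_inv_unique[OF D.category_axioms inv F_Hom[OF s]] zpath_Bwd by blast
    then show ?case
      using step[OF C.zpath_single_Bwd[OF zpath_Bwd(1) s] zpath_Bwd(3)] zpath_Bwd by simp
  qed
qed

end


section \<open>Serre subcategories, quotients and closed objects\<close>

text \<open>A full subcategory is given by its set of objects.\<close>

definition serre_subcategory :: "('o, 'm, 'z) pcat_scheme \<Rightarrow> 'o set \<Rightarrow> bool" where
  "serre_subcategory A B \<longleftrightarrow> B \<subseteq> Obj A \<and> B \<noteq> {} \<and>
     (\<forall>i p. short_exact A i p \<longrightarrow> (Cod A i \<in> B \<longleftrightarrow> Dom A i \<in> B \<and> Cod A p \<in> B))"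

definition serre_isos :: "('o, 'm, 'z) pcat_scheme \<Rightarrow> 'o set \<Rightarrow> 'm set" where
  "serre_isos A B = {f \<in> Arr A. (\<exists>k. is_kernel A f k \<and> Dom A k \<in> B) \<and>
     (\<exists>c. is_cokernel A f c \<and> Cod A c \<in> B)}"

text \<open>The quotient by a Serre subcategory is the localization at the arrows whose kernel and
  cokernel lie in the subcategory.\<close>

definition serre_quotient ::
  "('o, 'm, 'z) pcat_scheme \<Rightarrow> 'o set \<Rightarrow> ('o, 'o \<times> 'm zstep list set \<times> 'o) cat" where
  "serre_quotient A B = localization A (serre_isos A B)"

definition quotient_functor ::
  "('o, 'm, 'z) pcat_scheme \<Rightarrow> 'o set \<Rightarrow> ('o, 'm, 'o, 'o \<times> 'm zstep list set \<times> 'o) func" where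
  "quotient_functor A B = localization_functor A (serre_isos A B)"

definition closed_objects :: "('o, 'm, 'z) pcat_scheme \<Rightarrow> 'o set \<Rightarrow> 'o set" where
  "closed_objects A B = {a \<in> Obj A. \<forall>b \<in> B.
     Hom A b a = {Zero A b a} \<and> Ext1 A b a = {Ext1_zero A b a}}"

end

theory Submission
  imports Defs
begin

text \<open>If \<open>e\<close> is \<open>B\<close>-closed, precomposition with an arrow \<open>s\<close> whose kernel and cokernel lie in \<open>B\<close> is a
  bijection from \<open>Hom (Cod s) e\<close> onto \<open>Hom (Dom s) e\<close>: since \<open>Hom(B, e) = 0\<close> it is injective and every
  arrow into \<open>e\<close> factors through the image of \<open>s\<close>; it then extends from the image because the pushout
  extension of \<open>coker s\<close> by \<open>e\<close> splits.  So zigzags act on arrows into \<open>e\<close>, a backward step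
  acting by the inverse bijection.  The action respects the defining congruence of the localization,
  and letting a zigzag ending at \<open>e\<close> act on the identity of \<open>e\<close> inverts the quotient functor on arrows
  into \<open>e\<close>.\<close>

section \<open>Preadditive categories\<close>

context category
begin

abbreviation comp (infixr "\<cdot>" 70) where
  "g \<cdot> f \<equiv> Comp C g f"

lemma HomD:
  assumes "f \<in> Hom C a b"
  shows "f \<in> Arr C" "Dom C f = a" "Cod C f = b" "a \<in> Obj C" "b \<in> Obj C"
  using assms Dom_closed Cod_closed by (auto simp: Hom_def)

lemma Arr_Hom: "f \<in> Arr C \<Longrightarrow> f \<in> Hom C (Dom C f) (Cod C f)"
  by (simp add: Hom_def)

lemma is_epi_cancel:
  assumes "is_epi C f" "f \<in> Hom C a b" "g \<in> Hom C b x" "h \<in> Hom C b x" "g \<cdot> f = h \<cdot> f"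
  shows "g = h"
  using assms HomD[OF assms(2)] by (auto simp: is_epi_def)

lemma is_epi_Comp:
  assumes f: "is_epi C f" "f \<in> Hom C a b" and g: "is_epi C g" "g \<in> Hom C b c"
  shows "is_epi C (g \<cdot> f)"
proof -
  note gf = Comp_closed[OF f(2) g(2)]
  have "u = v" if u: "u \<in> Hom C c x" and v: "v \<in> Hom C c x" and eq: "u \<cdot> g \<cdot> f = v \<cdot> g \<cdot> f" for x u v
  proof -
    have "(u \<cdot> g) \<cdot> f = (v \<cdot> g) \<cdot> f"
      using eq Comp_assoc[OF f(2) g(2) u] Comp_assoc[OF f(2) g(2) v] by simp
    then have "u \<cdot> g = v \<cdot> g"
      by (rule is_epi_cancel[OF f Comp_closed[OF g(2) u] Comp_closed[OF g(2) v]])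
    then show ?thesis by (rule is_epi_cancel[OF g u v])
  qed
  then show ?thesis using HomD[OF gf] by (auto simp: is_epi_def)
qed

end

context preadditive_category
begin

section \<open>Arithmetic in the Hom groups\<close>

lemma Add_closed: "f \<in> Hom C a b \<Longrightarrow> g \<in> Hom C a b \<Longrightarrow> Add C f g \<in> Hom C a b"
  using monoid.m_closed[OF comm_group.axioms(2)[OF Hom_comm_group, THEN group.is_monoid], of a b f g]
    HomD[of f a b]
  by (simp add: Hom_group_def)

lemma Zero_closed: "a \<in> Obj C \<Longrightarrow> b \<in> Obj C \<Longrightarrow> Zero C a b \<in> Hom C a b"
  using monoid.one_closed[OF comm_group.axioms(2)[OF Hom_comm_group, THEN group.is_monoid], of a b]
  by (simp add: Hom_group_def)

lemma Add_Zero_left: "f \<in> Hom C a b \<Longrightarrow> Add C (Zero C a b) f = f"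
  using monoid.l_one[OF comm_group.axioms(2)[OF Hom_comm_group, THEN group.is_monoid], of a b f]
    HomD[of f a b]
  by (simp add: Hom_group_def)

lemma Add_Zero_right: "f \<in> Hom C a b \<Longrightarrow> Add C f (Zero C a b) = f"
  using monoid.r_one[OF comm_group.axioms(2)[OF Hom_comm_group, THEN group.is_monoid], of a b f]
    HomD[of f a b]
  by (simp add: Hom_group_def)

lemma Add_assoc:
  assumes "f \<in> Hom C a b" "g \<in> Hom C a b" "h \<in> Hom C a b"
  shows "Add C (Add C f g) h = Add C f (Add C g h)"
  using monoid.m_assoc[OF comm_group.axioms(2)[OF Hom_comm_group, THEN group.is_monoid], of a b f g h]
    HomD[OF assms(1)] assms
  by (simp add: Hom_group_def)

lemma ex_Add_inverse:
  assumes "f \<in> Hom C a b"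
  obtains g where "g \<in> Hom C a b" "Add C f g = Zero C a b" "Add C g f = Zero C a b"
proof -
  interpret H: comm_group "Hom_group C a b" using Hom_comm_group HomD[OF assms] by blast
  have f: "f \<in> carrier (Hom_group C a b)" using assms by (simp add: Hom_group_def)
  show ?thesis
    using that[of "m_inv (Hom_group C a b) f"] H.inv_closed[OF f] H.r_inv[OF f] H.l_inv[OF f]
    by (simp add: Hom_group_def)
qed

lemma Add_right_cancel:
  assumes f: "f \<in> Hom C a b" and g: "g \<in> Hom C a b" and h: "h \<in> Hom C a b"
    and eq: "Add C f h = Add C g h"
  shows "f = g"
proof -
  obtain k where k: "k \<in> Hom C a b" "Add C h k = Zero C a b" using ex_Add_inverse[OF h] by blast
  have "f = Add C (Add C f h) k" using Add_assoc[OF f h k(1)] by (simp add: k Add_Zero_right[OF f])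
  also have "\<dots> = g" using Add_assoc[OF g h k(1)] by (simp add: eq k Add_Zero_right[OF g])
  finally show ?thesis .
qed

text \<open>Serves to show that composites with a zero arrow vanish: by bilinearity such a composite
  added to itself is unchanged.\<close>

lemma Add_idem_eq_Zero:
  assumes "f \<in> Hom C a b" "Add C f f = f"
  shows "f = Zero C a b"
  using assms HomD[OF assms(1)]
  by (intro Add_right_cancel[OF assms(1) Zero_closed assms(1)]) (auto simp: Add_Zero_left)

lemma Comp_Zero_right:
  assumes "a \<in> Obj C" "g \<in> Hom C b c"
  shows "g \<cdot> Zero C a b = Zero C a c"
proof -
  have z: "Zero C a b \<in> Hom C a b" using assms HomD[OF assms(2)] by (auto intro: Zero_closed)
  show ?thesis
    using Comp_Add_right[OF z z assms(2)]
    by (intro Add_idem_eq_Zero Comp_closed[OF z assms(2)]) (simp add: Add_Zero_left[OF z])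
qed

lemma Comp_Zero_left:
  assumes "c \<in> Obj C" "f \<in> Hom C a b"
  shows "Zero C b c \<cdot> f = Zero C a c"
proof -
  have z: "Zero C b c \<in> Hom C b c" using assms HomD[OF assms(2)] by (auto intro: Zero_closed)
  show ?thesis
    using Comp_Add_left[OF assms(2) z z]
    by (intro Add_idem_eq_Zero Comp_closed[OF assms(2) z]) (simp add: Add_Zero_left[OF z])
qed

text \<open>Subtraction is not part of the category record, so a difference \<open>g - h\<close> is
  written \<open>Add C g n\<close> with \<open>n\<close> an additive inverse of
  \<open>h\<close>.\<close>

lemma eq_if_diff_Zero:
  assumes g: "g \<in> Hom C a b" and h: "h \<in> Hom C a b" and n: "n \<in> Hom C a b"
    and hn: "Add C h n = Zero C a b" and gn: "Add C g n = Zero C a b"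
  shows "g = h"
  using Add_right_cancel[OF g h n] hn gn by simp

text \<open>If \<open>f\<close> identifies \<open>g\<close> and \<open>h\<close>, it kills their
  difference, so testing \<open>f\<close> on zero composites is enough.\<close>

lemma is_monoI:
  assumes f: "f \<in> Hom C a b"
    and *: "\<And>x t. t \<in> Hom C x a \<Longrightarrow> f \<cdot> t = Zero C x b \<Longrightarrow> t = Zero C x a"
  shows "is_mono C f"
proof -
  have "g = h" if g: "g \<in> Hom C x a" and h: "h \<in> Hom C x a" and eq: "f \<cdot> g = f \<cdot> h" for x g h
  proof -
    obtain n where n: "n \<in> Hom C x a" "Add C h n = Zero C x a" using ex_Add_inverse[OF h] by blast
    have "f \<cdot> Add C g n = f \<cdot> Add C h n"
      using Comp_Add_right[OF g n(1) f] Comp_Add_right[OF h n(1) f] eq by simp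
    then have "Add C g n = Zero C x a"
      using *[OF Add_closed[OF g n(1)]] n(2) Comp_Zero_right[OF HomD(4)[OF g] f] by simp
    then show ?thesis using eq_if_diff_Zero[OF g h n] by blast
  qed
  then show ?thesis using HomD[OF f] by (auto simp: is_mono_def)
qed

lemma is_mono_Zero:
  assumes "is_mono C f" "f \<in> Hom C a b" "t \<in> Hom C x a" "f \<cdot> t = Zero C x b"
  shows "t = Zero C x a"
proof -
  have "Zero C x a \<in> Hom C x a" "f \<cdot> Zero C x a = Zero C x b"
    using assms HomD[OF assms(3)] by (auto intro: Zero_closed Comp_Zero_right)
  then show ?thesis using assms HomD[OF assms(2)] by (auto simp: is_mono_def)
qed

lemma is_epi_Zero:
  assumes "is_epi C f" "f \<in> Hom C a b" "t \<in> Hom C b x" "t \<cdot> f = Zero C a x"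
  shows "t = Zero C b x"
  using assms HomD[OF assms(3)]
  by (intro is_epi_cancel[OF assms(1-3)]) (auto intro: Zero_closed simp: Comp_Zero_left)

section \<open>Kernels and cokernels\<close>

lemma is_kernelD:
  assumes "is_kernel C f k" "f \<in> Hom C a b"
  shows "k \<in> Hom C (Dom C k) a" "f \<cdot> k = Zero C (Dom C k) b"
  using assms HomD[OF assms(2)] by (auto simp: is_kernel_def)

lemma is_kernel_lift:
  assumes "is_kernel C f k" "f \<in> Hom C a b" "g \<in> Hom C x a" "f \<cdot> g = Zero C x b"
  obtains h where "h \<in> Hom C x (Dom C k)" "k \<cdot> h = g"
  using assms HomD[OF assms(2)] unfolding is_kernel_def by metis

text \<open>Lifts along the mono \<open>k\<close> are automatically unique, so only their existence
  remains to be checked.\<close>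

lemma is_kernelI:
  assumes f: "f \<in> Hom C a b" and k: "k \<in> Hom C d a" "f \<cdot> k = Zero C d b" "is_mono C k"
    and "\<And>x g. g \<in> Hom C x a \<Longrightarrow> f \<cdot> g = Zero C x b \<Longrightarrow> \<exists>h \<in> Hom C x d. k \<cdot> h = g"
  shows "is_kernel C f k"
  using assms(5) k HomD[OF f] HomD[OF k(1)] unfolding is_kernel_def is_mono_def by metis

lemma is_cokernelD:
  assumes "is_cokernel C f c" "f \<in> Hom C a b"
  shows "c \<in> Hom C b (Cod C c)" "c \<cdot> f = Zero C a (Cod C c)"
  using assms HomD[OF assms(2)] by (auto simp: is_cokernel_def)

lemma is_cokernel_desc:
  assumes "is_cokernel C f c" "f \<in> Hom C a b" "g \<in> Hom C b x" "g \<cdot> f = Zero C a x"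
  obtains h where "h \<in> Hom C (Cod C c) x" "h \<cdot> c = g"
  using assms HomD[OF assms(2)] unfolding is_cokernel_def by metis

lemma is_cokernelI:
  assumes f: "f \<in> Hom C a b" and c: "c \<in> Hom C b d" "c \<cdot> f = Zero C a d" "is_epi C c"
    and "\<And>x g. g \<in> Hom C b x \<Longrightarrow> g \<cdot> f = Zero C a x \<Longrightarrow> \<exists>h \<in> Hom C d x. h \<cdot> c = g"
  shows "is_cokernel C f c"
  using assms(5) c HomD[OF f] HomD[OF c(1)] unfolding is_cokernel_def is_epi_def by metis

lemma is_cokernel_is_epi:
  assumes c: "is_cokernel C f c" and f: "f \<in> Hom C a b"
  shows "is_epi C c"
proof -
  note c' = is_cokernelD[OF c f]
  have "g = h" if g: "g \<in> Hom C (Cod C c) x" and h: "h \<in> Hom C (Cod C c) x" and eq: "g \<cdot> c = h \<cdot> c"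
    for x g h
  proof -
    \<comment> \<open>Both \<open>g\<close> and \<open>h\<close> are descents of the arrow
      \<open>h \<cdot> c\<close>, which kills \<open>f\<close>; uniqueness of the descent identifies
      them.\<close>
    have "(h \<cdot> c) \<cdot> f = Zero C a x"
      using Comp_assoc[OF f c'(1) h] Comp_Zero_right[OF HomD(4)[OF f] h] c'(2) by simp
    then have "\<exists>!k. k \<in> Hom C (Cod C c) x \<and> k \<cdot> c = h \<cdot> c"
      using c Comp_closed[OF c'(1) h] HomD[OF f] by (auto simp: is_cokernel_def)
    then show ?thesis using g h eq by metis
  qed
  then show ?thesis using HomD[OF c'(1)] by (auto simp: is_epi_def)
qed

end

section \<open>Abelian categories\<close>

context abelian_category
begin

text \<open>The mono \<open>m\<close> is a kernel of some \<open>f\<close>. As \<open>f\<close>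
  kills \<open>m\<close>, it factors through \<open>c\<close>, so whatever \<open>c\<close> kills is
  killed by \<open>f\<close> and lifts through \<open>m\<close>.\<close>

lemma mono_is_kernel_of_cokernel:
  assumes m: "is_mono C m" "m \<in> Hom C a b" and c: "is_cokernel C m c"
  shows "is_kernel C c m"
proof -
  obtain f where f: "is_kernel C f m" using mono_is_kernel[OF m(1)] by blast
  note c' = is_cokernelD[OF c m(2)]
  have f': "f \<in> Hom C b (Cod C f)" "f \<cdot> m = Zero C a (Cod C f)"
    using f HomD[OF m(2)] by (auto simp: is_kernel_def Hom_def)
  obtain h where h: "h \<in> Hom C (Cod C c) (Cod C f)" "h \<cdot> c = f"
    using is_cokernel_desc[OF c m(2) f'] by blast
  show ?thesis
  proof (rule is_kernelI[OF c'(1) m(2) c'(2) m(1)])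
    fix x g assume g: "g \<in> Hom C x b" "c \<cdot> g = Zero C x (Cod C c)"
    have "f \<cdot> g = Zero C x (Cod C f)"
      using Comp_assoc[OF g(1) c'(1) h(1)] h(2) g(2) Comp_Zero_right[OF HomD(4)[OF g(1)] h(1)] by simp
    then show "\<exists>h \<in> Hom C x a. m \<cdot> h = g"
      using is_kernel_lift[OF f f'(1) g(1)] HomD[OF m(2)] by metis
  qed
qed

text \<open>To see that the arrow \<open>m\<close> from the coimage is mono, let \<open>m \<cdot> t = 0\<close> and \<open>d = coker t\<close>.  The
  epimorphism \<open>d \<cdot> e\<close> is a cokernel of some \<open>u\<close>; as \<open>m\<close> factors through \<open>d\<close>, \<open>s \<cdot> u = 0\<close>, so \<open>e \<cdot> u = 0\<close>, and
  \<open>e\<close> factors through \<open>d \<cdot> e\<close>.  Hence \<open>d\<close> has a left inverse and \<open>t = 0\<close>.\<close>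

lemma coimage_mono:
  assumes s: "s \<in> Hom C a b" and k: "is_kernel C s k" and e: "is_cokernel C k e"
    and m: "m \<in> Hom C (Cod C e) b" and me: "m \<cdot> e = s"
  shows "is_mono C m"
proof (rule is_monoI[OF m])
  fix x t assume t: "t \<in> Hom C x (Cod C e)" and mt: "m \<cdot> t = Zero C x b"
  note k' = is_kernelD[OF k s]
  note e' = is_cokernelD[OF e k'(1)]
  have ee: "is_epi C e" by (rule is_cokernel_is_epi[OF e k'(1)])
  obtain d where d: "is_cokernel C t d" using ex_cokernel HomD(1)[OF t] by blast
  note d' = is_cokernelD[OF d t]
  have de: "is_epi C d" by (rule is_cokernel_is_epi[OF d t])
  obtain m' where m': "m' \<in> Hom C (Cod C d) b" "m' \<cdot> d = m" using is_cokernel_desc[OF d t m mt] by blast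
  note ded = Comp_closed[OF e'(1) d'(1)]
  obtain u where u: "is_cokernel C u (d \<cdot> e)"
    using epi_is_cokernel[OF is_epi_Comp[OF ee e'(1) de d'(1)]] by blast
  have u1: "u \<in> Hom C (Dom C u) a"
    using u HomD[OF ded] unfolding is_cokernel_def by (auto simp: Hom_def)
  have u2: "(d \<cdot> e) \<cdot> u = Zero C (Dom C u) (Cod C d)"
    using is_cokernelD(2)[OF u u1] HomD[OF ded] by simp
  have "s = m' \<cdot> (d \<cdot> e)" using Comp_assoc[OF e'(1) d'(1) m'(1)] m'(2) me by simp
  then have "s \<cdot> u = Zero C (Dom C u) b"
    using Comp_assoc[OF u1 ded m'(1)] u2 Comp_Zero_right[OF HomD(4)[OF u1] m'(1)] by simp
  then obtain v where v: "v \<in> Hom C (Dom C u) (Dom C k)" "k \<cdot> v = u"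
    using is_kernel_lift[OF k s u1] by blast
  have "e \<cdot> u = Zero C (Dom C u) (Cod C e)"
    using Comp_assoc[OF v(1) k'(1) e'(1)] v(2) e'(2) Comp_Zero_left[OF HomD(5)[OF e'(1)] v(1)] by simp
  then obtain y where y: "y \<in> Hom C (Cod C d) (Cod C e)" "y \<cdot> d \<cdot> e = e"
    using is_cokernel_desc[OF u u1 e'(1)] HomD[OF ded] by metis
  have yd: "y \<cdot> d = Ident C (Cod C e)"
    using is_epi_cancel[OF ee e'(1) Comp_closed[OF d'(1) y(1)] Ident_closed[OF HomD(5)[OF e'(1)]]]
      Comp_assoc[OF e'(1) d'(1) y(1)] y(2) Ident_left[OF e'(1)] by simp
  show "t = Zero C x (Cod C e)"
    using Comp_assoc[OF t d'(1) y(1)] d'(2) Comp_Zero_right[OF HomD(4)[OF t] y(1)] Ident_left[OF t] yd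
    by simp
qed

text \<open>The pushout of \<open>m\<close> and \<open>f\<close> is built as the cokernel
  \<open>q\<close> of \<open>(m, -f)\<close> from \<open>a\<close> into the biproduct of
  \<open>b\<close> and \<open>x\<close>. The arrow \<open>i\<close> opposite \<open>m\<close> is
  again mono, and its cokernel has the same target as \<open>c\<close>.\<close>

lemma short_exact_pushout:
  assumes m: "is_mono C m" "m \<in> Hom C a b" and c: "is_cokernel C m c" and f: "f \<in> Hom C a x"
  obtains i p j where "short_exact C i p" "i \<in> Hom C x (Cod C i)" "Cod C p = Cod C c"
    "j \<in> Hom C b (Cod C i)" "j \<cdot> m = i \<cdot> f"
proof -
  note c' = is_cokernelD[OF c m(2)]
  have ce: "is_epi C c" by (rule is_cokernel_is_epi[OF c m(2)])
  obtain y i1 i2 p1 p2 where "is_biproduct C b x y i1 i2 p1 p2"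
    using ex_biproduct HomD(5)[OF m(2)] HomD(5)[OF f] by blast
  then have i1: "i1 \<in> Hom C b y" and i2: "i2 \<in> Hom C x y" and p1: "p1 \<in> Hom C y b"
    and p2: "p2 \<in> Hom C y x" and p1i1: "p1 \<cdot> i1 = Ident C b" and p2i2: "p2 \<cdot> i2 = Ident C x"
    and p1i2: "p1 \<cdot> i2 = Zero C x b"
    and sum: "Add C (i1 \<cdot> p1) (i2 \<cdot> p2) = Ident C y"
    by (auto simp: is_biproduct_def)
  obtain n where n: "n \<in> Hom C a x" "Add C f n = Zero C a x" "Add C n f = Zero C a x"
    using ex_Add_inverse[OF f] by blast
  define u where "u = Add C (i1 \<cdot> m) (i2 \<cdot> n)"
  note i1m = Comp_closed[OF m(2) i1] and i2n = Comp_closed[OF n(1) i2] and i2f = Comp_closed[OF f i2]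
  have u: "u \<in> Hom C a y" unfolding u_def by (rule Add_closed[OF i1m i2n])
  have p1u: "p1 \<cdot> u = m"
  proof -
    have "p1 \<cdot> u = Add C (p1 \<cdot> i1 \<cdot> m) (p1 \<cdot> i2 \<cdot> n)"
      unfolding u_def by (rule Comp_Add_right[OF i1m i2n p1])
    also have "\<dots> = Add C m (Zero C a b)"
      using Comp_assoc[OF m(2) i1 p1] Comp_assoc[OF n(1) i2 p1] p1i1 p1i2 Ident_left[OF m(2)]
        Comp_Zero_left[OF HomD(5)[OF m(2)] n(1)] by simp
    finally show ?thesis using Add_Zero_right[OF m(2)] by simp
  qed
  \<comment> \<open>Since \<open>q\<close> will kill \<open>u\<close>, this identity yields the
    commutative square \<open>sq\<close>.\<close>
  have uf: "i1 \<cdot> m = Add C u (i2 \<cdot> f)"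
  proof -
    have "Add C (i2 \<cdot> n) (i2 \<cdot> f) = Zero C a y"
      using Comp_Add_right[OF n(1) f i2] n(3) Comp_Zero_right[OF HomD(4)[OF f] i2] by simp
    then show ?thesis unfolding u_def
      using Add_assoc[OF i1m i2n i2f] Add_Zero_right[OF i1m] by simp
  qed
  have um: "is_mono C u"
  proof (rule is_monoI[OF u])
    fix z t assume t: "t \<in> Hom C z a" "u \<cdot> t = Zero C z y"
    then have "m \<cdot> t = Zero C z b"
      using Comp_assoc[OF t(1) u p1] p1u Comp_Zero_right[OF HomD(4)[OF t(1)] p1] by simp
    then show "t = Zero C z a" by (rule is_mono_Zero[OF m t(1)])
  qed
  \<comment> \<open>As \<open>u\<close> is mono, it is also the kernel of \<open>q\<close>; this is
    what shows below that \<open>i\<close> is mono.\<close>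
  obtain q where q: "is_cokernel C u q" using ex_cokernel HomD(1)[OF u] by blast
  note q' = is_cokernelD[OF q u]
  have qe: "is_epi C q" by (rule is_cokernel_is_epi[OF q u])
  have qk: "is_kernel C q u" by (rule mono_is_kernel_of_cokernel[OF um u q])
  define P where "P = Cod C q"
  note q1 = q'(1)[folded P_def] and q2 = q'(2)[folded P_def]
  note j = Comp_closed[OF i1 q1] and i = Comp_closed[OF i2 q1]
  note jm = Comp_assoc[OF m(2) i1 q1] and if' = Comp_assoc[OF f i2 q1]
  have sq: "(q \<cdot> i1) \<cdot> m = (q \<cdot> i2) \<cdot> f"
    using Comp_Add_right[OF u i2f q1] uf q2 Add_Zero_left[OF Comp_closed[OF i2f q1]] jm if' by simp
  have cp1: "c \<cdot> p1 \<in> Hom C y (Cod C c)" by (rule Comp_closed[OF p1 c'(1)])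
  have "(c \<cdot> p1) \<cdot> u = Zero C a (Cod C c)" using Comp_assoc[OF u p1 c'(1)] p1u c'(2) by simp
  then obtain p where p: "p \<in> Hom C P (Cod C c)" "p \<cdot> q = c \<cdot> p1"
    using is_cokernel_desc[OF q u cp1] unfolding P_def by blast
  have pi: "p \<cdot> q \<cdot> i2 = Zero C x (Cod C c)"
    using Comp_assoc[OF i2 q1 p(1)] p(2) Comp_assoc[OF i2 p1 c'(1)] p1i2
      Comp_Zero_right[OF HomD(5)[OF f] c'(1)] by simp
  have pj: "p \<cdot> q \<cdot> i1 = c"
    using Comp_assoc[OF i1 q1 p(1)] p(2) Comp_assoc[OF i1 p1 c'(1)] p1i1 Ident_right[OF c'(1)] by simp
  \<comment> \<open>If \<open>q \<cdot> i2\<close> kills \<open>t\<close>, then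
    \<open>i2 \<cdot> t\<close> lifts through \<open>u\<close> to some \<open>w\<close>. The
    component in \<open>b\<close> shows \<open>m \<cdot> w = 0\<close>, so \<open>w = 0\<close>, and
    projecting to \<open>x\<close> gives \<open>t = 0\<close>.\<close>
  have im: "is_mono C (q \<cdot> i2)"
  proof (rule is_monoI[OF i])
    fix z t assume t: "t \<in> Hom C z x" "(q \<cdot> i2) \<cdot> t = Zero C z P"
    note i2t = Comp_closed[OF t(1) i2]
    have "q \<cdot> i2 \<cdot> t = Zero C z P" using Comp_assoc[OF t(1) i2 q1] t(2) by simp
    then obtain w where w: "w \<in> Hom C z a" "u \<cdot> w = i2 \<cdot> t"
      using is_kernel_lift[OF qk q1 i2t] HomD[OF u] by metis
    have "m \<cdot> w = Zero C z b"
      using Comp_assoc[OF w(1) u p1] p1u w(2) Comp_assoc[OF t(1) i2 p1] p1i2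
        Comp_Zero_left[OF HomD(5)[OF m(2)] t(1)] by simp
    then have "w = Zero C z a" by (rule is_mono_Zero[OF m w(1)])
    then have "i2 \<cdot> t = Zero C z y" using w(2) Comp_Zero_right[OF HomD(4)[OF t(1)] u] by simp
    then show "t = Zero C z x"
      using Comp_assoc[OF t(1) i2 p2] p2i2 Ident_left[OF t(1)]
        Comp_Zero_right[OF HomD(4)[OF t(1)] p2] by simp
  qed
  \<comment> \<open>The composite of \<open>p\<close> with \<open>j = q \<cdot> i1\<close> is the
    epi \<open>c\<close>, which forces \<open>p\<close> to be epi.\<close>
  have pe: "is_epi C p"
  proof -
    have "g = h" if g: "g \<in> Hom C (Cod C c) z" and h: "h \<in> Hom C (Cod C c) z" and "g \<cdot> p = h \<cdot> p"
      for z g h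
    proof -
      have "g \<cdot> c = h \<cdot> c"
        using Comp_assoc[OF j p(1) g] Comp_assoc[OF j p(1) h] pj that by simp
      then show ?thesis by (rule is_epi_cancel[OF ce c'(1) g h])
    qed
    then show ?thesis using HomD[OF p(1)] by (auto simp: is_epi_def)
  qed
  have pc: "is_cokernel C (q \<cdot> i2) p"
  proof (rule is_cokernelI[OF i p(1) pi pe])
    fix z g assume g: "g \<in> Hom C P z" "g \<cdot> q \<cdot> i2 = Zero C x z"
    note gq = Comp_closed[OF q1 g(1)] and gj = Comp_closed[OF j g(1)]
    have "(g \<cdot> q \<cdot> i1) \<cdot> m = Zero C a z"
      using Comp_assoc[OF m(2) j g(1)] sq Comp_assoc[OF f i g(1)] g(2)
        Comp_Zero_left[OF HomD(5)[OF g(1)] f] by simp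
    then obtain h where h: "h \<in> Hom C (Cod C c) z" "h \<cdot> c = g \<cdot> q \<cdot> i1"
      using is_cokernel_desc[OF c m(2) gj] by blast
    \<comment> \<open>The identity of the biproduct is split into its two summands: on
      \<open>x\<close> the arrow \<open>g \<cdot> q\<close> vanishes, and on \<open>b\<close> it
      agrees with \<open>h \<cdot> c\<close>.\<close>
    have "(h \<cdot> p) \<cdot> q = g \<cdot> q"
    proof -
      have "g \<cdot> q = (g \<cdot> q) \<cdot> Add C (i1 \<cdot> p1) (i2 \<cdot> p2)" using sum Ident_right[OF gq] by simp
      also have "\<dots> = Add C ((g \<cdot> q) \<cdot> i1 \<cdot> p1) ((g \<cdot> q) \<cdot> i2 \<cdot> p2)"
        by (rule Comp_Add_right[OF Comp_closed[OF p1 i1] Comp_closed[OF p2 i2] gq])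
      also have "(g \<cdot> q) \<cdot> i2 \<cdot> p2 = Zero C y z"
        using Comp_assoc[OF p2 i2 gq] Comp_assoc[OF i2 q1 g(1)] g(2)
          Comp_Zero_left[OF HomD(5)[OF g(1)] p2] by simp
      also have "(g \<cdot> q) \<cdot> i1 \<cdot> p1 = h \<cdot> c \<cdot> p1"
        using Comp_assoc[OF p1 i1 gq] Comp_assoc[OF i1 q1 g(1)] h(2) Comp_assoc[OF p1 c'(1) h(1)] by simp
      also have "Add C (h \<cdot> c \<cdot> p1) (Zero C y z) = h \<cdot> c \<cdot> p1"
        by (rule Add_Zero_right[OF Comp_closed[OF cp1 h(1)]])
      finally show ?thesis using Comp_assoc[OF q1 p(1) h(1)] p(2) by simp
    qed
    then have "h \<cdot> p = g" by (rule is_epi_cancel[OF qe q1 Comp_closed[OF p(1) h(1)] g(1)])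
    then show "\<exists>h \<in> Hom C (Cod C c) z. h \<cdot> p = g" using h(1) by blast
  qed
  have "short_exact C (q \<cdot> i2) p"
    unfolding short_exact_def using pc mono_is_kernel_of_cokernel[OF im i pc] by blast
  then show ?thesis
    using that[of "q \<cdot> i2" p "q \<cdot> i1"] i j sq HomD(3)[OF p(1)] HomD(3)[OF i] by simp
qed

section \<open>Arrows into closed objects\<close>

lemma closed_object_Hom_Zero:
  assumes "e \<in> closed_objects C B" "b \<in> B" "f \<in> Hom C b e"
  shows "f = Zero C b e"
  using assms by (auto simp: closed_objects_def)

text \<open>\<open>Ext1\<close> is a set of classes whose only element here is the split class. By
  reflexivity \<open>(i, p)\<close> lies in its own class, so it comes from a biproduct, and the
  projection onto \<open>e\<close> is the retraction.\<close>

lemma closed_object_extension_splits: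
  assumes e: "e \<in> closed_objects C B" and se: "short_exact C i p" and i: "i \<in> Hom C e (Cod C i)"
    and b: "Cod C p \<in> B"
  obtains r where "r \<in> Hom C (Cod C i) e" "r \<cdot> i = Ident C e"
proof -
  define y where "y = Cod C i"
  have p: "p \<in> Hom C y (Cod C p)"
    using se HomD[OF i] by (auto simp: short_exact_def is_cokernel_def y_def)
  have x: "(i, p) \<in> extensions C (Cod C p) e" using se HomD[OF i] by (simp add: extensions_def)
  have id: "Ident C y \<in> Hom C y y" by (rule Ident_closed[OF HomD(4)[OF p]])
  have "is_iso C (Ident C y)"
    using id HomD[OF id] Ident_left[OF id] by (auto simp: is_iso_def)
  then have refl: "((i, p), (i, p)) \<in> ext_equiv C (Cod C p) e"
    using x id Ident_left[OF i] Ident_right[OF p] by (auto simp: ext_equiv_def y_def)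
  have "ext_equiv C (Cod C p) e `` {(i, p)} \<in> Ext1 C (Cod C p) e"
    unfolding Ext1_def by (rule quotientI[OF x])
  then have "ext_equiv C (Cod C p) e `` {(i, p)} = Ext1_zero C (Cod C p) e"
    using e b by (auto simp: closed_objects_def)
  then have "(i, p) \<in> Ext1_zero C (Cod C p) e" using refl by blast
  then obtain z r s where "is_biproduct C e (Cod C p) z i s r p" by (auto simp: Ext1_zero_def)
  then show ?thesis using that[of r] by (auto simp: is_biproduct_def Hom_def)
qed

text \<open>Factor \<open>s\<close> as the epi \<open>d\<close> onto its coimage followed by a mono
  \<open>m\<close>. Vanishing of Hom carries \<open>f\<close> down along \<open>d\<close>, and
  vanishing of \<open>Ext1\<close> then extends it along \<open>m\<close>.\<close>

lemma closed_object_extend: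
  assumes e: "e \<in> closed_objects C B" and s: "s \<in> serre_isos C B" "s \<in> Hom C a b"
    and f: "f \<in> Hom C a e"
  shows "\<exists>g \<in> Hom C b e. g \<cdot> s = f"
proof -
  obtain k c where k: "is_kernel C s k" "Dom C k \<in> B" and c: "is_cokernel C s c" "Cod C c \<in> B"
    using s(1) by (auto simp: serre_isos_def)
  note k' = is_kernelD[OF k(1) s(2)] and c' = is_cokernelD[OF c(1) s(2)]
  obtain d where d: "is_cokernel C k d" using ex_cokernel HomD(1)[OF k'(1)] by blast
  note d' = is_cokernelD[OF d k'(1)]
  have de: "is_epi C d" by (rule is_cokernel_is_epi[OF d k'(1)])
  obtain m where m: "m \<in> Hom C (Cod C d) b" "m \<cdot> d = s"
    using is_cokernel_desc[OF d k'(1) s(2) k'(2)] by blast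
  have mm: "is_mono C m" by (rule coimage_mono[OF s(2) k(1) d m])
  \<comment> \<open>Because \<open>d\<close> is epi, an arrow kills \<open>m\<close> exactly when it
    kills \<open>s = m \<cdot> d\<close>. Hence \<open>m\<close> inherits the cokernel of
    \<open>s\<close>, whose object lies in \<open>B\<close>.\<close>
  have cm: "is_cokernel C m c"
  proof (rule is_cokernelI[OF m(1) c'(1) _ is_cokernel_is_epi[OF c(1) s(2)]])
    show "c \<cdot> m = Zero C (Cod C d) (Cod C c)"
      using is_epi_Zero[OF de d'(1) Comp_closed[OF m(1) c'(1)]] Comp_assoc[OF d'(1) m(1) c'(1)] m(2) c'(2)
      by simp
    fix x g assume g: "g \<in> Hom C b x" "g \<cdot> m = Zero C (Cod C d) x"
    have "g \<cdot> s = Zero C a x"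
      using Comp_assoc[OF d'(1) m(1) g(1)] m(2) g(2) Comp_Zero_left[OF HomD(5)[OF g(1)] d'(1)] by simp
    then show "\<exists>h \<in> Hom C (Cod C c) x. h \<cdot> c = g" using is_cokernel_desc[OF c(1) s(2) g(1)] by blast
  qed
  have "f \<cdot> k = Zero C (Dom C k) e"
    by (rule closed_object_Hom_Zero[OF e k(2) Comp_closed[OF k'(1) f]])
  then obtain f' where f': "f' \<in> Hom C (Cod C d) e" "f' \<cdot> d = f"
    using is_cokernel_desc[OF d k'(1) f] by blast
  \<comment> \<open>Pushing out along \<open>f'\<close> gives an extension of an object of
    \<open>B\<close> by \<open>e\<close>. Its retraction \<open>r\<close> turns \<open>j\<close>
    into an extension of \<open>f'\<close> to \<open>b\<close>.\<close>
  obtain i p j where se: "short_exact C i p" and i: "i \<in> Hom C e (Cod C i)"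
    and p: "Cod C p = Cod C c" and j: "j \<in> Hom C b (Cod C i)" "j \<cdot> m = i \<cdot> f'"
    using short_exact_pushout[OF mm m(1) cm f'(1)] by blast
  obtain r where r: "r \<in> Hom C (Cod C i) e" "r \<cdot> i = Ident C e"
    using closed_object_extension_splits[OF e se i] p c(2) by metis
  have "(r \<cdot> j) \<cdot> m = f'"
    using Comp_assoc[OF m(1) j(1) r(1)] j(2) Comp_assoc[OF f'(1) i r(1)] r(2) Ident_left[OF f'(1)]
    by simp
  then have "(r \<cdot> j) \<cdot> s = f"
    using Comp_assoc[OF d'(1) m(1) Comp_closed[OF j(1) r(1)]] m(2) f'(2) by simp
  then show ?thesis using Comp_closed[OF j(1) r(1)] by blast
qed

text \<open>The difference of \<open>g\<close> and \<open>h\<close> kills \<open>s\<close>, so it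
  factors through the cokernel of \<open>s\<close>; an arrow from that object of \<open>B\<close> to
  \<open>e\<close> is zero.\<close>

lemma closed_object_cancel:
  assumes e: "e \<in> closed_objects C B" and s: "s \<in> serre_isos C B" "s \<in> Hom C a b"
    and g: "g \<in> Hom C b e" and h: "h \<in> Hom C b e" and eq: "g \<cdot> s = h \<cdot> s"
  shows "g = h"
proof -
  obtain c where c: "is_cokernel C s c" "Cod C c \<in> B" using s(1) by (auto simp: serre_isos_def)
  note c' = is_cokernelD[OF c(1) s(2)]
  obtain n where n: "n \<in> Hom C b e" "Add C h n = Zero C b e" using ex_Add_inverse[OF h] by blast
  have "Add C g n \<cdot> s = Add C h n \<cdot> s"
    using Comp_Add_left[OF s(2) g n(1)] Comp_Add_left[OF s(2) h n(1)] eq by simp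
  then have "Add C g n \<cdot> s = Zero C a e" using n(2) Comp_Zero_left[OF HomD(5)[OF g] s(2)] by simp
  then obtain t where t: "t \<in> Hom C (Cod C c) e" "t \<cdot> c = Add C g n"
    using is_cokernel_desc[OF c(1) s(2) Add_closed[OF g n(1)]] by blast
  have "Add C g n = Zero C b e"
    using t(2) closed_object_Hom_Zero[OF e c(2) t(1)] Comp_Zero_left[OF HomD(5)[OF g] c'(1)] by simp
  then show ?thesis using eq_if_diff_Zero[OF g h n] by blast
qed

end

section \<open>The action of zigzags on arrows into a local object\<close>

text \<open>The action is contravariant: \<open>g\<close> starts at the end of the zigzag, the
  result at its beginning. The \<open>THE\<close> is meaningful only when the arrow reached so far
  has a unique extension along \<open>s\<close>, as \<open>local_object\<close> guarantees for
  \<open>s\<close> in \<open>S\<close>.\<close>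

primrec zact :: "('o, 'm, 'z) cat_scheme \<Rightarrow> 'o \<Rightarrow> 'm zstep list \<Rightarrow> 'm \<Rightarrow> 'm" where
  "zact C e [] g = g"
| "zact C e (x # w) g = (case x of Fwd f \<Rightarrow> Comp C (zact C e w g) f
     | Bwd s \<Rightarrow> THE h. h \<in> Hom C (Cod C s) e \<and> Comp C h s = zact C e w g)"

text \<open>Isolates the two facts about closed objects that the zigzag argument uses, free of any
  additive structure. Such an \<open>e\<close> is usually called \<open>S\<close>-local.\<close>

locale local_object = category C
  for C :: "('o, 'm, 'z) cat_scheme" +
  fixes S :: "'m set" and e :: 'o
  assumes e_Obj: "e \<in> Obj C"
    and local_ex: "s \<in> S \<Longrightarrow> s \<in> Hom C a b \<Longrightarrow> f \<in> Hom C a e \<Longrightarrow> \<exists>g \<in> Hom C b e. Comp C g s = f"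
    and local_cancel: "s \<in> S \<Longrightarrow> s \<in> Hom C a b \<Longrightarrow> g \<in> Hom C b e \<Longrightarrow> h \<in> Hom C b e
      \<Longrightarrow> Comp C g s = Comp C h s \<Longrightarrow> g = h"
begin

lemma zact_append: "zact C e (v @ w) g = zact C e v (zact C e w g)"
  by (induction v) (simp_all split: zstep.split)

lemma zact_Bwd_eq:
  assumes s: "s \<in> S" "s \<in> Hom C a b" and h: "h \<in> Hom C b e" "h \<cdot> s = zact C e w g"
  shows "zact C e (Bwd s # w) g = h"
proof -
  have "(THE h. h \<in> Hom C b e \<and> h \<cdot> s = zact C e w g) = h"
  proof (rule the_equality)
    fix h' assume h': "h' \<in> Hom C b e \<and> h' \<cdot> s = zact C e w g"
    show "h' = h" by (rule local_cancel[OF s]) (simp_all add: h h')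
  qed (simp add: h)
  then show ?thesis using HomD[OF s(2)] by simp
qed

lemma zact_Bwd:
  assumes s: "s \<in> S" "s \<in> Hom C a b" and w: "zact C e w g \<in> Hom C a e"
  shows "zact C e (Bwd s # w) g \<in> Hom C b e" "zact C e (Bwd s # w) g \<cdot> s = zact C e w g"
proof -
  obtain h where h: "h \<in> Hom C b e" "h \<cdot> s = zact C e w g" using local_ex[OF s w] by blast
  show "zact C e (Bwd s # w) g \<in> Hom C b e" "zact C e (Bwd s # w) g \<cdot> s = zact C e w g"
    unfolding zact_Bwd_eq[OF s h] by (fact h)+
qed

lemma zact_Hom: "zpath C S a w b \<Longrightarrow> g \<in> Hom C b e \<Longrightarrow> zact C e w g \<in> Hom C a e"
proof (induction rule: zpath.induct)
  case (zpath_Fwd f w b)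
  then show ?case using Comp_closed[OF Arr_Hom] by simp
next
  case (zpath_Bwd s w b)
  then show ?case using zact_Bwd(1)[OF zpath_Bwd(1) Arr_Hom] by blast
qed simp

lemma zact_zeq: "zeq C S a b w w' \<Longrightarrow> g \<in> Hom C b e \<Longrightarrow> zact C e w g = zact C e w' g"
proof (induction arbitrary: g rule: zeq.induct)
  case (zeq_append a b v v' c w w')
  have "zact C e w g \<in> Hom C b e"
    using zact_Hom conjunct1[OF zeq_zpath[OF zeq_append(2)]] zeq_append.prems by blast
  then show ?case using zeq_append.IH zeq_append.prems by (simp add: zact_append)
next
  case (zeq_Comp f a b h c)
  then show ?case using Comp_assoc[OF zeq_Comp(1,2)] by simp
next
  case (zeq_Ident a)
  then show ?case using Ident_right by simp
next
  case (zeq_Fwd_Bwd s a b)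
  then show ?case using zact_Bwd(2)[OF zeq_Fwd_Bwd(1,2), of "[]" g] by simp
next
  \<comment> \<open>Here \<open>g\<close> itself is the unique extension of
    \<open>g \<cdot> s\<close> along \<open>s\<close>.\<close>
  case (zeq_Bwd_Fwd s a b)
  then show ?case using zact_Bwd_eq[OF zeq_Bwd_Fwd(1,2,3), of "[Fwd s]" g] by simp
qed auto

text \<open>A final step into \<open>e\<close> absorbs the steps before it one at a time, from right
  to left: forward steps by composition, backward steps by extension.\<close>

lemma zeq_zact:
  "zpath C S a w b \<Longrightarrow> g \<in> Hom C b e \<Longrightarrow> zeq C S a e (w @ [Fwd g]) [Fwd (zact C e w g)]"
proof (induction rule: zpath.induct)
  case (zpath_Nil a)
  then show ?case by (simp add: zeq_refl zpath_single_Fwd)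
next
  case (zpath_Fwd f w b)
  let ?h = "zact C e w g"
  note f = Arr_Hom[OF zpath_Fwd(1)]
  have "zeq C S (Dom C f) e ([Fwd f] @ w @ [Fwd g]) ([Fwd f] @ [Fwd ?h])"
    using zpath_Fwd by (intro zeq_append[OF zeq_refl[OF zpath_single_Fwd[OF f]]]) simp
  from zeq_trans[OF this, unfolded append_Cons append_Nil, OF zeq_Comp[OF f zact_Hom[OF zpath_Fwd(2,4)]]]
  show ?case by simp
next
  case (zpath_Bwd s w b)
  let ?h = "zact C e w g" and ?k = "zact C e (Bwd s # w) g"
  note s = Arr_Hom[OF zpath_Bwd(2)]
  note k = zact_Bwd[OF zpath_Bwd(1) s zact_Hom[OF zpath_Bwd(3,5)]]
  have B: "zeq C S (Cod C s) (Dom C s) [Bwd s] [Bwd s]"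
    by (rule zeq_refl[OF zpath_single_Bwd[OF zpath_Bwd(1) s]])
  have "zeq C S (Cod C s) e ([Bwd s] @ w @ [Fwd g]) ([Bwd s] @ [Fwd ?h])"
    using zpath_Bwd by (intro zeq_append[OF B]) simp
  \<comment> \<open>As \<open>?k\<close> extends \<open>?h\<close> along \<open>s\<close>, the step
    \<open>Fwd ?h\<close> splits into \<open>Fwd s\<close> and \<open>Fwd ?k\<close>, and
    \<open>Fwd s\<close> then cancels against \<open>Bwd s\<close>.\<close>
  also have "zeq C S (Cod C s) e ([Bwd s] @ [Fwd ?h]) ([Bwd s] @ [Fwd s, Fwd ?k])"
    using zeq_Comp[OF s k(1), of S] unfolding k(2) by (rule zeq_append[OF B zeq_sym])
  also (zeq_trans) have "[Bwd s] @ [Fwd s, Fwd ?k] = [Bwd s, Fwd s] @ [Fwd ?k]" by simp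
  also have "zeq C S (Cod C s) e ([Bwd s, Fwd s] @ [Fwd ?k]) ([] @ [Fwd ?k])"
    by (rule zeq_append[OF zeq_Bwd_Fwd[OF zpath_Bwd(1) s] zeq_refl[OF zpath_single_Fwd[OF k(1)]]])
  finally (zeq_trans) show ?case by (simp del: zact.simps)
qed

lemma localization_functor_bij:
  "bij_betw (FArr (localization_functor C S)) (Hom C a e) (Hom (localization C S) a e)"
proof -
  have q: "FArr (localization_functor C S) f = (a, zclass C S a e [Fwd f], e)" if "f \<in> Hom C a e" for f
    using HomD[OF that] by (simp add: localization_functor_def)
  note id = Ident_closed[OF e_Obj]
  show ?thesis
    unfolding bij_betw_def
  proof
    show "inj_on (FArr (localization_functor C S)) (Hom C a e)"
    proof (rule inj_onI)
      fix f g assume f: "f \<in> Hom C a e" and g: "g \<in> Hom C a e"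
        and "FArr (localization_functor C S) f = FArr (localization_functor C S) g"
      then have "zeq C S a e [Fwd f] [Fwd g]"
        using zclass_eq_iff[OF zpath_single_Fwd[OF g]] by (simp add: q)
      \<comment> \<open>The zigzag \<open>[Fwd f]\<close> takes the identity of \<open>e\<close> to
        \<open>f\<close>, so \<open>f\<close> can be recovered from its class.\<close>
      from zact_zeq[OF this id] show "f = g" using Ident_left[OF f] Ident_left[OF g] by simp
    qed
    show "FArr (localization_functor C S) ` Hom C a e = Hom (localization C S) a e"
    proof
      show "FArr (localization_functor C S) ` Hom C a e \<subseteq> Hom (localization C S) a e"
        by (auto simp: q Hom_localization intro: zpath_single_Fwd)
      show "Hom (localization C S) a e \<subseteq> FArr (localization_functor C S) ` Hom C a e"
      proof
        fix x assume "x \<in> Hom (localization C S) a e"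
        then obtain w where w: "zpath C S a w e" "x = (a, zclass C S a e w, e)"
          by (auto simp: Hom_localization)
        let ?f = "zact C e w (Ident C e)"
        have f: "?f \<in> Hom C a e" by (rule zact_Hom[OF w(1) id])
        \<comment> \<open>An identity step is appended so that \<open>zeq_zact\<close> has a final
          arrow into \<open>e\<close> to work with.\<close>
        have "zeq C S a e (w @ []) (w @ [Fwd (Ident C e)])"
          by (rule zeq_append[OF zeq_refl[OF w(1)] zeq_sym[OF zeq_Ident[OF e_Obj]]])
        from zeq_trans[OF this zeq_zact[OF w(1) id]] have "zeq C S a e w [Fwd ?f]" by simp
        then have "x = FArr (localization_functor C S) ?f"
          using zclass_eq_iff[OF zpath_single_Fwd[OF f]] by (simp add: q[OF f] w(2))
        then show "x \<in> FArr (localization_functor C S) ` Hom C a e" using f by blast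
      qed
    qed
  qed
qed

end

lemma (in abelian_category) closed_object_local:
  assumes "e \<in> closed_objects C B"
  shows "local_object C (serre_isos C B) e"
proof
  show "e \<in> Obj C" using assms by (simp add: closed_objects_def)
qed (use closed_object_extend[OF assms] closed_object_cancel[OF assms] in blast)+

section \<open>Full subcategories\<close>

lemma full_subcat_simps [simp]:
  "Obj (full_subcat C X) = Obj C \<inter> X"
  "Arr (full_subcat C X) = {f \<in> Arr C. Dom C f \<in> X \<and> Cod C f \<in> X}"
  "Dom (full_subcat C X) = Dom C" "Cod (full_subcat C X) = Cod C"
  "Ident (full_subcat C X) = Ident C" "Comp (full_subcat C X) = Comp C"
  by (simp_all add: full_subcat_def)

lemma Hom_full_subcat:
  "Hom (full_subcat C X) a b = (if a \<in> X \<and> b \<in> X then Hom C a b else {})"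
  by (auto simp: Hom_def)

lemma (in category) category_full_subcat: "category (full_subcat C X)"
proof
  fix a b c d f g h
  assume "f \<in> Hom (full_subcat C X) a b" "g \<in> Hom (full_subcat C X) b c"
    "h \<in> Hom (full_subcat C X) c d"
  then have "f \<in> Hom C a b" "g \<in> Hom C b c" "h \<in> Hom C c d"
    by (auto simp: Hom_full_subcat split: if_splits)
  from Comp_assoc[OF this]
  show "Comp (full_subcat C X) h (Comp (full_subcat C X) g f)
    = Comp (full_subcat C X) (Comp (full_subcat C X) h g) f"
    by simp
qed (auto simp: Hom_full_subcat Dom_closed Cod_closed Ident_closed Ident_left
    Ident_right intro: Comp_closed split: if_splits)

lemma is_functor_restrict:
  assumes "is_functor C D F"
  shows "is_functor (full_subcat C X) D (func_comp F inclusion_functor)"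
proof -
  interpret category C using assms by (simp add: is_functor_def)
  show ?thesis
    using assms category_full_subcat
    by (auto simp: is_functor_def Hom_full_subcat func_comp_def inclusion_functor_def
        split: if_splits)
qed

theorem corollary3p2:
  fixes A :: "('o, 'm, 'z) pcat_scheme" and B :: "'o set"
  assumes "abelian_category A"
    and "serre_subcategory A B"
  shows "fully_faithful (full_subcat A (closed_objects A B)) (serre_quotient A B)
    (func_comp (quotient_functor A B) inclusion_functor)"
proof -
  interpret abelian_category A by (rule assms(1))
  \<comment> \<open>Closedness enters through the target \<open>e\<close>; for closed
    \<open>a\<close> the left-hand Hom set is that of the full subcategory.\<close>
  have "bij_betw (FArr (quotient_functor A B)) (Hom A a e) (Hom (serre_quotient A B) a e)"
    if "e \<in> closed_objects A B" for a e
    using local_object.localization_functor_bij[OF closed_object_local[OF that]]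
    by (simp add: quotient_functor_def serre_quotient_def)
  moreover have "FObj (quotient_functor A B) a = a" for a
    by (simp add: quotient_functor_def localization_functor_def)
  moreover have "is_functor (full_subcat A (closed_objects A B)) (serre_quotient A B)
      (func_comp (quotient_functor A B) inclusion_functor)"
    unfolding serre_quotient_def quotient_functor_def
    by (rule is_functor_restrict[OF is_functor_localization])
  ultimately show ?thesis
    by (simp add: fully_faithful_def Hom_full_subcat func_comp_def inclusion_functor_def comp_def)
qed

end
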